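(* For all $n \in \mathbb{N}$ and all partitions $\lambda$ and $\mu$ of $n$, we have $\lambda \trianglerighteq \mu$ if and only if $C(\lambda,\mu,X)$ holds for every $\mathbb{N}$-valued random variable $X$ with $X \in TN_2$.
   Context: $\mathbb{N}$ denotes the set of non-negative integers. A partition is a non-increasing function $\lambda:\mathbb{N}\setminus\{0\}\to\mathbb{N}$ with finite support; its weight is $|\lambda|=\sum_i \lambda(i)$, and $\lambda$ is a partition of $n$ if $|\lambda|=n$. Dominance: $\lambda \trianglerighteq \mu$ iff $|\lambda|=|\mu|$ and $\sum_{i=1}^j \lambda(i) \ge \sum_{i=1}^j \mu(i)$ for all positive integers $j$. For a real sequence $p=\{p_n\}_{n\ge 0}$ let $\mathcal{T}_p$ be the $\mathbb{N}\times\mathbb{N}$ matrix with $(\mathcal{T}_p)_{i,j}=p_{j-i}$, where $p_n=0$ for $n<0$. A matrix is $TN_k$ if all its minors of order at most $k$ are non-negative. For an $\mathbb{N}$-valued random variable $X$, $X\in TN_2$ means $\mathcal{T}_{p}\in TN_2$ for $p=\{P(X=n)\}_{n\ge0}$. For a partition $\nu$, let $Y_1,Y_2,\ldots$ be independent random variables, where $Y_i$ is distributed as the sum of $\nu(i)$ independent copies of $X$ (and $Y_i\equiv 0$ if $\nu(i)=0$). For $j,t\in\mathbb{N}$, $E(\nu,X,j,t)$ is the event that $Y_i\le t$ for all $i\ge1$ and $\sum_{i\ge1} Y_i=j$. For partitions $\lambda,\mu$, $C(\lambda,\mu,X)$ is the condition that $P(E(\lambda,X,j,t))\le P(E(\mu,X,j,t))$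 for all $j,t\in\mathbb{N}$. *)

theory Defs
  imports "HOL-Probability.Probability" "Jordan_Normal_Form.Determinant"
begin

text \<open>
  A sequence indexed by the positive integers is a function on \<^typ>\<open>nat\<close> whose value at \<^term>\<open>0::nat\<close>
  is never inspected. For finitely supported \<open>f\<close>, \<open>total_sum f\<close> is the sum of \<open>f i\<close> over all \<open>i \<ge> 1\<close>.
\<close>

definition total_sum :: "(nat \<Rightarrow> nat) \<Rightarrow> nat" where
  "total_sum f = (\<Sum>i | i \<ge> 1 \<and> f i \<noteq> 0. f i)"

definition is_partition :: "(nat \<Rightarrow> nat) \<Rightarrow> bool" where
  "is_partition \<nu> \<longleftrightarrow> antimono_on {1..} \<nu> \<and> finite {i. i \<ge> 1 \<and> \<nu> i \<noteq> 0}"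

definition is_partition_of :: "(nat \<Rightarrow> nat) \<Rightarrow> nat \<Rightarrow> bool" where
  "is_partition_of \<nu> n \<longleftrightarrow> is_partition \<nu> \<and> total_sum \<nu> = n"

definition dominates :: "(nat \<Rightarrow> nat) \<Rightarrow> (nat \<Rightarrow> nat) \<Rightarrow> bool" where
  "dominates \<nu> \<mu> \<longleftrightarrow> total_sum \<nu> = total_sum \<mu> \<and> (\<forall>j\<ge>1. (\<Sum>i=1..j. \<mu> i) \<le> (\<Sum>i=1..j. \<nu> i))"

definition toeplitz :: "(nat \<Rightarrow> real) \<Rightarrow> nat \<Rightarrow> nat \<Rightarrow> real" where
  "toeplitz p i j = (if i \<le> j then p (j - i) else 0)"

text \<open>
  Matrices indexed by \<open>\<nat> \<times> \<nat>\<close> are binary functions; a minor of order \<open>m\<close> is given by increasing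
  lists of \<open>m\<close> row indices \<open>r 0, \<dots>, r (m - 1)\<close> and of \<open>m\<close> column indices \<open>c 0, \<dots>, c (m - 1)\<close>.
\<close>

definition minor :: "(nat \<Rightarrow> nat \<Rightarrow> real) \<Rightarrow> nat \<Rightarrow> (nat \<Rightarrow> nat) \<Rightarrow> (nat \<Rightarrow> nat) \<Rightarrow> real" where
  "minor A m r c = Determinant.det (Matrix.mat m m (\<lambda>(a, b). A (r a) (c b)))"

definition TN :: "nat \<Rightarrow> (nat \<Rightarrow> nat \<Rightarrow> real) \<Rightarrow> bool" where
  "TN k A \<longleftrightarrow> (\<forall>m\<le>k. \<forall>r c. strict_mono_on {..<m} r \<longrightarrow> strict_mono_on {..<m} c \<longrightarrow> 0 \<le> minor A m r c)"

text \<open>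
  An \<open>\<nat>\<close>-valued random variable \<open>X\<close> enters only through its law, a \<^typ>\<open>nat pmf\<close>.
\<close>

definition rv_TN2 :: "nat pmf \<Rightarrow> bool" where
  "rv_TN2 X \<longleftrightarrow> TN 2 (toeplitz (\<lambda>n. pmf X n))"

definition sum_of_copies :: "nat \<Rightarrow> nat pmf \<Rightarrow> nat pmf" where
  "sum_of_copies m X = map_pmf (\<lambda>x. \<Sum>k<m. x k) (Pi_pmf {..<m} 0 (\<lambda>_. X))"

text \<open>
  The joint law of \<open>Y\<^sub>1, Y\<^sub>2, \<dots>\<close>, for a partition \<open>\<nu>\<close>: the coordinates with \<open>\<nu> i > 0\<close> are independent,
  and all other coordinates are identically \<^term>\<open>0::nat\<close>, the default value of \<^const>\<open>Pi_pmf\<close>.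
\<close>

definition law_Y :: "(nat \<Rightarrow> nat) \<Rightarrow> nat pmf \<Rightarrow> (nat \<Rightarrow> nat) pmf" where
  "law_Y \<nu> X = Pi_pmf {i. i \<ge> 1 \<and> \<nu> i \<noteq> 0} 0 (\<lambda>i. sum_of_copies (\<nu> i) X)"

definition prob_E :: "(nat \<Rightarrow> nat) \<Rightarrow> nat pmf \<Rightarrow> nat \<Rightarrow> nat \<Rightarrow> real" where
  "prob_E \<nu> X j t = measure_pmf.prob (law_Y \<nu> X) {Y. (\<forall>i\<ge>1. Y i \<le> t) \<and> total_sum Y = j}"

definition cond_C :: "(nat \<Rightarrow> nat) \<Rightarrow> (nat \<Rightarrow> nat) \<Rightarrow> nat pmf \<Rightarrow> bool" where
  "cond_C \<nu> \<mu> X \<longleftrightarrow> (\<forall>j t. prob_E \<nu> X j t \<le> prob_E \<mu> X j t)"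

text \<open>
  \<^const>\<open>prob_E\<close> is the probability of the event for every realisation of \<open>Y\<^sub>1, Y\<^sub>2, \<dots>\<close> on an
  arbitrary probability space.
\<close>

lemma (in prob_space) prob_E_realisation:
  fixes Y :: "nat \<Rightarrow> 'a \<Rightarrow> nat"
  assumes part: "is_partition \<nu>"
    and indep: "indep_vars (\<lambda>_. count_space UNIV) Y {1..}"
    and law: "\<And>i. i \<ge> 1 \<Longrightarrow> distr M (count_space UNIV) (Y i) = measure_pmf (sum_of_copies (\<nu> i) X)"
    and zero: "\<And>i \<omega>. i \<ge> 1 \<Longrightarrow> \<nu> i = 0 \<Longrightarrow> \<omega> \<in> space M \<Longrightarrow> Y i \<omega> = 0"
  shows "prob {\<omega> \<in> space M. (\<forall>i\<ge>1. Y i \<omega> \<le> t) \<and> total_sum (\<lambda>i. Y i \<omega>) = j} = prob_E \<nu> X j t"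
proof -
  define A where "A = {i. i \<ge> 1 \<and> \<nu> i \<noteq> 0}"
  have fin: "finite A" using part by (simp add: A_def is_partition_def)
  have A1: "i \<ge> 1" if "i \<in> A" for i using that by (simp add: A_def)
  have meas: "random_variable (count_space UNIV) (Y i)" if "i \<ge> 1" for i
    using indep that by (auto simp: indep_vars_def2)
  define F where "F = {f \<in> PiE_dflt A 0 (\<lambda>_. {..t}). total_sum f = j}"
  have finF: "finite F"
    unfolding F_def by (rule finite_subset[of _ "PiE_dflt A 0 (\<lambda>_. {..t})"]) (use fin in auto)
  define G where "G f = {\<omega> \<in> space M. \<forall>i\<in>A. Y i \<omega> = f i}" for f
  have Gev: "G f \<in> events" for f
    unfolding G_def using fin
  proof (rule sets.sets_Collect_finite_All[rotated])
    fix i assume "i \<in> A"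
    then have "Y i -` {f i} \<inter> space M \<in> events"
      using meas[of i] A1 by (intro measurable_sets[of _ _ "count_space UNIV"]) auto
    also have "Y i -` {f i} \<inter> space M = {\<omega> \<in> space M. Y i \<omega> = f i}" by auto
    finally show "{\<omega> \<in> space M. Y i \<omega> = f i} \<in> events" .
  qed
  have Gprob: "prob (G f) = pmf (law_Y \<nu> X) f" if "f \<in> F" for f
  proof -
    have "f i = 0" if "i \<notin> A" for i
      using \<open>f \<in> F\<close> that by (auto simp: F_def PiE_dflt_def)
    then have R: "pmf (law_Y \<nu> X) f = (\<Prod>i\<in>A. pmf (sum_of_copies (\<nu> i) X) (f i))"
      unfolding law_Y_def A_def[symmetric] using fin by (subst pmf_Pi') auto
    show ?thesis
    proof (cases "A = {}")
      case True
      then show ?thesis using R by (simp add: G_def prob_space)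
    next
      case False
      have "prob (\<Inter>i\<in>A. Y i -` {f i} \<inter> space M) = (\<Prod>i\<in>A. prob (Y i -` {f i} \<inter> space M))"
        using False fin A1 by (intro indep_varsD[OF indep]) auto
      also have "(\<Inter>i\<in>A. Y i -` {f i} \<inter> space M) = G f"
        using False by (auto simp: G_def)
      also have "(\<Prod>i\<in>A. prob (Y i -` {f i} \<inter> space M)) = (\<Prod>i\<in>A. pmf (sum_of_copies (\<nu> i) X) (f i))"
      proof (rule prod.cong[OF refl])
        fix i assume "i \<in> A"
        then have i: "i \<ge> 1" using A1 by auto
        have "prob (Y i -` {f i} \<inter> space M) = measure (distr M (count_space UNIV) (Y i)) {f i}"
          using meas[OF i] by (simp add: measure_distr)
        also have "\<dots> = pmf (sum_of_copies (\<nu> i) X) (f i)"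
          unfolding law[OF i] by (simp add: measure_pmf_single)
        finally show "prob (Y i -` {f i} \<inter> space M) = pmf (sum_of_copies (\<nu> i) X) (f i)" .
      qed
      finally show ?thesis using R by simp
    qed
  qed
  have total_eq: "total_sum f = total_sum g" if "\<And>i. i \<ge> 1 \<Longrightarrow> f i = g i" for f g
    unfolding total_sum_def by (rule sum.cong) (use that in auto)
  have "{\<omega> \<in> space M. (\<forall>i\<ge>1. Y i \<omega> \<le> t) \<and> total_sum (\<lambda>i. Y i \<omega>) = j} = (\<Union>f\<in>F. G f)"
  proof (intro equalityI subsetI)
    fix \<omega> assume w: "\<omega> \<in> {\<omega> \<in> space M. (\<forall>i\<ge>1. Y i \<omega> \<le> t) \<and> total_sum (\<lambda>i. Y i \<omega>) = j}"
    define f where "f i = (if i \<in> A then Y i \<omega> else 0)" for i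
    have "total_sum f = total_sum (\<lambda>i. Y i \<omega>)"
      by (rule total_eq) (use w zero in \<open>auto simp: f_def A_def\<close>)
    then have "f \<in> F" using w A1 by (auto simp: F_def PiE_dflt_def f_def)
    moreover have "\<omega> \<in> G f" using w by (auto simp: G_def f_def)
    ultimately show "\<omega> \<in> (\<Union>f\<in>F. G f)" by blast
  next
    fix \<omega> assume "\<omega> \<in> (\<Union>f\<in>F. G f)"
    then obtain f where f: "f \<in> F" and w: "\<omega> \<in> space M" and e: "\<And>i. i \<in> A \<Longrightarrow> Y i \<omega> = f i"
      by (auto simp: G_def)
    have eq: "Y i \<omega> = f i" if "i \<ge> 1" for i
      using e[of i] f zero[OF that _ w] that
      by (cases "i \<in> A") (auto simp: A_def F_def PiE_dflt_def)
    have le: "f i \<le> t" for i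
      using f by (cases "i \<in> A") (auto simp: F_def PiE_dflt_def)
    have "total_sum (\<lambda>i. Y i \<omega>) = total_sum f" by (rule total_eq) (rule eq)
    then show "\<omega> \<in> {\<omega> \<in> space M. (\<forall>i\<ge>1. Y i \<omega> \<le> t) \<and> total_sum (\<lambda>i. Y i \<omega>) = j}"
      using f w eq le by (auto simp: F_def)
  qed
  also have "prob (\<Union>f\<in>F. G f) = (\<Sum>f\<in>F. prob (G f))"
  proof (rule finite_measure_finite_Union[OF finF])
    show "disjoint_family_on G F"
      unfolding disjoint_family_on_def
    proof (intro ballI impI)
      fix f g assume "f \<in> F" "g \<in> F" "f \<noteq> g"
      then obtain i where "i \<in> A" "f i \<noteq> g i"
        by (force simp: F_def PiE_dflt_def fun_eq_iff)
      then show "G f \<inter> G g = {}" by (auto simp: G_def)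
    qed
  qed (use Gev in auto)
  also have "\<dots> = measure_pmf.prob (law_Y \<nu> X) F"
    using finF Gprob by (simp add: measure_measure_pmf_finite)
  also have "\<dots> = prob_E \<nu> X j t"
    unfolding prob_E_def
  proof (rule measure_eq_AE)
    have "set_pmf (law_Y \<nu> X) \<subseteq> {f. \<forall>i. i \<notin> A \<longrightarrow> f i = 0}"
      unfolding law_Y_def A_def[symmetric] using fin by (rule set_Pi_pmf_subset)
    then show "AE f in measure_pmf (law_Y \<nu> X). (f \<in> F) = (f \<in> {Y. (\<forall>i\<ge>1. Y i \<le> t) \<and> total_sum Y = j})"
      using A1 by (fastforce simp: AE_measure_pmf_iff F_def PiE_dflt_def)
  qed auto
  finally show ?thesis .
qed

end

theory Submission
  imports Defs "HOL-Computational_Algebra.Formal_Power_Series"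
begin

text \<open>
  With \<open>P\<close> the generating function of \<open>X\<close>, the probability of \<open>E(\<nu>,X,j,t)\<close> is the coefficient of
  index \<open>j\<close> in the product of the powers \<open>P ^ \<nu> i\<close>, each cut off above degree \<open>t\<close>. If \<open>X \<in> TN\<^sub>2\<close>, all
  powers of \<open>P\<close> are \<open>TN\<^sub>2\<close> as well, so \<open>P ^ b\<close> is below \<open>P ^ c\<close> in the likelihood ratio order for
  \<open>b \<le> c\<close>; hence moving one copy of \<open>X\<close> from a larger part \<open>a\<close> to a part \<open>b \<le> a - 2\<close> can only
  increase every coefficient, and dominance is generated by such moves. Conversely, for fair coin
  flips the largest \<open>j\<close> for which \<open>E(\<nu>,X,j,t)\<close> is possible is \<open>\<Sum> min (\<nu> i) t\<close>, and these numbers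
  determine dominance.
\<close>

section \<open>Order-two total positivity and its closure under convolution\<close>

text \<open>Averaging the sum with its reindexing by \<open>\<sigma>\<close> replaces
  \<open>w x\<close> by half of \<open>w x - w (\<sigma> x)\<close>, so only the sign of this
  difference against \<open>d x\<close> matters. Used for swapped index pairs and for reflected
  indices.\<close>

lemma sum_nonneg_involution:
  fixes w d :: "'a \<Rightarrow> real"
  assumes "\<And>x. x \<in> S \<Longrightarrow> \<sigma> x \<in> S" and "\<And>x. x \<in> S \<Longrightarrow> \<sigma> (\<sigma> x) = x"
    and anti: "\<And>x. x \<in> S \<Longrightarrow> d (\<sigma> x) = - d x"
    and nonneg: "\<And>x. x \<in> S \<Longrightarrow> 0 \<le> (w x - w (\<sigma> x)) * d x"
  shows "0 \<le> (\<Sum>x\<in>S. w x * d x)"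
proof -
  have "(\<Sum>x\<in>S. w x * d x) = (\<Sum>x\<in>S. w (\<sigma> x) * d (\<sigma> x))"
    by (rule sum.reindex_bij_witness[of _ \<sigma> \<sigma>]) (use assms in auto)
  also have "\<dots> = (\<Sum>x\<in>S. - (w (\<sigma> x) * d x))"
    using anti by (intro sum.cong) auto
  finally have "2 * (\<Sum>x\<in>S. w x * d x) = (\<Sum>x\<in>S. (w x - w (\<sigma> x)) * d x)"
    by (simp add: algebra_simps sum_subtractf sum_negf)
  also have "\<dots> \<ge> 0" using nonneg by (rule sum_nonneg)
  finally show ?thesis by simp
qed

text \<open>The second-order minors are written out without determinants. The index inequalities are
  weak because for \<open>i = i'\<close> or \<open>j = j'\<close> the two products coincide.\<close>

definition PF2 :: "(nat \<Rightarrow> real) \<Rightarrow> bool" where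
  "PF2 q \<longleftrightarrow> (\<forall>n. 0 \<le> q n) \<and>
     (\<forall>i i' j j'. i \<le> i' \<longrightarrow> j \<le> j' \<longrightarrow>
        toeplitz q i j' * toeplitz q i' j \<le> toeplitz q i j * toeplitz q i' j')"

lemma PF2_minor:
  assumes "PF2 q" "i \<le> i'" "j \<le> j'"
  shows "toeplitz q i j' * toeplitz q i' j \<le> toeplitz q i j * toeplitz q i' j'"
  using assms unfolding PF2_def by blast

lemma minor_2: "minor A 2 r c = A (r 0) (c 0) * A (r 1) (c 1) - A (r 0) (c 1) * A (r 1) (c 0)"
proof -
  let ?M = "Matrix.mat 2 2 (\<lambda>(a, b). A (r a) (c b))"
  have "Determinant.det ?M = (\<Sum>b<2. ?M $$ (0, b) * cofactor ?M 0 b)"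
    by (rule laplace_expansion_row) auto
  then show ?thesis
    by (simp add: minor_def cofactor_def mat_delete_def det_single numeral_2_eq_2)
qed

lemma TN2_imp_PF2:
  assumes "TN 2 (toeplitz q)"
  shows "PF2 q"
  unfolding PF2_def
proof (intro conjI allI impI)
  fix n
  have "strict_mono_on {..<1} f" for f :: "nat \<Rightarrow> nat"
    by (auto simp: strict_mono_on_def)
  then have "0 \<le> minor (toeplitz q) 1 (\<lambda>_. 0) (\<lambda>_. n)"
    using assms unfolding TN_def by (meson one_le_numeral)
  then show "0 \<le> q n"
    by (simp add: minor_def toeplitz_def det_single)
next
  fix i i' j j' :: nat assume "i \<le> i'" "j \<le> j'"
  show "toeplitz q i j' * toeplitz q i' j \<le> toeplitz q i j * toeplitz q i' j'"
  proof (cases "i = i' \<or> j = j'")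
    case False
    define r where "r = (\<lambda>k::nat. if k = 0 then i else i')"
    define c where "c = (\<lambda>k::nat. if k = 0 then j else j')"
    have "strict_mono_on {..<2} r" "strict_mono_on {..<2} c"
      using False \<open>i \<le> i'\<close> \<open>j \<le> j'\<close> by (auto simp: strict_mono_on_def r_def c_def)
    then have "0 \<le> minor (toeplitz q) 2 r c"
      using assms unfolding TN_def by blast
    then show ?thesis by (simp add: minor_2 r_def c_def)
  qed auto
qed

lemma TN2_toeplitzI:
  assumes nonneg: "\<And>n. 0 \<le> q n"
    and minors: "\<And>i i' j j'. i < i' \<Longrightarrow> j < j' \<Longrightarrow>
      toeplitz q i j' * toeplitz q i' j \<le> toeplitz q i j * toeplitz q i' j'"
  shows "TN 2 (toeplitz q)"
  unfolding TN_def
proof (intro allI impI)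
  fix m :: nat and r c :: "nat \<Rightarrow> nat"
  assume "m \<le> 2" and r: "strict_mono_on {..<m} r" and c: "strict_mono_on {..<m} c"
  then consider "m = 0" | "m = 1" | "m = 2" by linarith
  then show "0 \<le> minor (toeplitz q) m r c"
  proof cases
    case 1
    then show ?thesis by (simp add: minor_def)
  next
    case 2
    then show ?thesis using nonneg by (simp add: minor_def det_single toeplitz_def)
  next
    case 3
    have "r 0 < r 1" "c 0 < c 1"
      using r c 3 by (auto simp: strict_mono_on_def)
    from minors[OF this] show ?thesis unfolding 3 minor_2 by simp
  qed
qed

text \<open>Toeplitz matrices are upper triangular, so in their product only \<open>k\<close>
  between \<open>i\<close> and \<open>j\<close> contributes. The free bound \<open>N\<close> lets
  all four entries of a minor be expanded over one index range.\<close>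

lemma toeplitz_fps_mult:
  assumes "j \<le> N"
  shows "toeplitz (fps_nth (f * g)) i j = (\<Sum>k\<le>N. toeplitz (fps_nth f) i k * toeplitz (fps_nth g) k j)"
proof -
  have "(\<Sum>k\<le>N. toeplitz (fps_nth f) i k * toeplitz (fps_nth g) k j)
      = (\<Sum>k\<in>{i..j}. toeplitz (fps_nth f) i k * toeplitz (fps_nth g) k j)"
    by (rule sum.mono_neutral_right) (use assms in \<open>auto simp: toeplitz_def\<close>)
  also have "\<dots> = toeplitz (fps_nth (f * g)) i j"
  proof (cases "i \<le> j")
    case True
    have "(\<Sum>k\<in>{i..j}. toeplitz (fps_nth f) i k * toeplitz (fps_nth g) k j)
        = (\<Sum>s=0..j - i. fps_nth f s * fps_nth g (j - i - s))"
      by (rule sum.reindex_bij_witness[of _ "\<lambda>s. s + i" "\<lambda>k. k - i"])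
         (use True in \<open>auto simp: toeplitz_def\<close>)
    then show ?thesis using True by (simp add: toeplitz_def fps_mult_nth)
  qed (auto simp: toeplitz_def)
  finally show ?thesis by simp
qed

text \<open>Cauchy--Binet for minors of order two, symmetrised over the two summation indices.\<close>

lemma PF2_mult:
  assumes f: "PF2 (fps_nth f)" and g: "PF2 (fps_nth g)"
  shows "PF2 (fps_nth (f * g))"
  unfolding PF2_def
proof (intro conjI allI impI)
  fix n show "0 \<le> fps_nth (f * g) n"
    using f g unfolding PF2_def fps_mult_nth by (auto intro!: sum_nonneg)
next
  fix i i' j j' :: nat assume i: "i \<le> i'" and j: "j \<le> j'"
  define K where "K = toeplitz (fps_nth f)"
  define L where "L = toeplitz (fps_nth g)"
  \<comment> \<open>\<open>d\<close> is the minor of \<open>L\<close> in rows \<open>k\<close>,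
    \<open>l\<close> and changes sign under the swap; \<open>w\<close> minus its swap is the minor
    of \<open>K\<close> in columns \<open>k\<close>, \<open>l\<close>. The order of \<open>k\<close>
    and \<open>l\<close> determines both signs.\<close>
  define d where "d = (\<lambda>(k, l). L k j * L l j' - L k j' * L l j)"
  define w where "w = (\<lambda>(k, l). K i k * K i' l)"
  have "0 \<le> (\<Sum>x\<in>{..j'} \<times> {..j'}. w x * d x)"
  proof (rule sum_nonneg_involution[where \<sigma> = prod.swap])
    fix x assume "x \<in> {..j'} \<times> {..j'}"
    obtain k l where x: "x = (k, l)" by (cases x)
    show "0 \<le> (w x - w (prod.swap x)) * d x"
    proof (cases "k \<le> l")
      case True
      have "0 \<le> w x - w (prod.swap x)" "0 \<le> d x"
        using PF2_minor[OF f i True] PF2_minor[OF g True j]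
        by (auto simp: x w_def d_def K_def L_def mult_ac)
      then show ?thesis by simp
    next
      case False
      then have "l \<le> k" by simp
      have "w x - w (prod.swap x) \<le> 0" "d x \<le> 0"
        using PF2_minor[OF f i \<open>l \<le> k\<close>] PF2_minor[OF g \<open>l \<le> k\<close> j]
        by (auto simp: x w_def d_def K_def L_def mult_ac)
      then show ?thesis by (rule mult_nonpos_nonpos)
    qed
  qed (auto simp: d_def)
  also have "(\<Sum>x\<in>{..j'} \<times> {..j'}. w x * d x) = (\<Sum>k\<le>j'. \<Sum>l\<le>j'. w (k, l) * d (k, l))"
    by (simp add: sum.cartesian_product)
  also have "\<dots>
      = (\<Sum>k\<le>j'. \<Sum>l\<le>j'. K i k * L k j * (K i' l * L l j')) -
        (\<Sum>k\<le>j'. \<Sum>l\<le>j'. K i k * L k j' * (K i' l * L l j))"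
    by (simp add: w_def d_def algebra_simps sum_subtractf)
  also have "\<dots> = toeplitz (fps_nth (f * g)) i j * toeplitz (fps_nth (f * g)) i' j' -
      toeplitz (fps_nth (f * g)) i j' * toeplitz (fps_nth (f * g)) i' j"
    using j by (simp add: toeplitz_fps_mult[where N = j'] sum_product K_def L_def)
  finally show "toeplitz (fps_nth (f * g)) i j' * toeplitz (fps_nth (f * g)) i' j
      \<le> toeplitz (fps_nth (f * g)) i j * toeplitz (fps_nth (f * g)) i' j'" by simp
qed

lemma PF2_power:
  assumes "PF2 (fps_nth f)"
  shows "PF2 (fps_nth (f ^ m))"
proof (induction m)
  case 0
  show ?case by (auto simp: PF2_def toeplitz_def)
next
  case (Suc m)
  then show ?case using assms by (simp add: PF2_mult)
qed

section \<open>Likelihood ratio order and truncated products\<close>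

text \<open>Likelihood ratio order with \<open>u\<close> the larger sequence: \<open>u / v\<close>
  is non-decreasing, cross-multiplied so that zeros are allowed.\<close>

definition lr_le :: "(nat \<Rightarrow> real) \<Rightarrow> (nat \<Rightarrow> real) \<Rightarrow> bool" where
  "lr_le v u \<longleftrightarrow> (\<forall>x y. x \<le> y \<longrightarrow> v y * u x \<le> v x * u y)"

text \<open>The minor of \<open>g\<close> in rows \<open>0\<close>, \<open>s\<close> and columns
  \<open>x\<close>, \<open>y\<close> compares \<open>g\<close> with its shift by \<open>s\<close>;
  mixing the shifts with the non-negative weights \<open>fps_nth r s\<close> preserves the
  comparison.\<close>

lemma lr_le_mult:
  assumes g: "PF2 (fps_nth g)" and r: "\<And>n. 0 \<le> fps_nth r n"
  shows "lr_le (fps_nth g) (fps_nth (r * g))"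
  unfolding lr_le_def
proof (intro allI impI)
  fix x y :: nat assume xy: "x \<le> y"
  have g0: "0 \<le> fps_nth g n" for n using g by (simp add: PF2_def)
  have "fps_nth g y * fps_nth (r * g) x = (\<Sum>s=0..x. fps_nth r s * (fps_nth g y * fps_nth g (x - s)))"
    by (simp add: fps_mult_nth sum_distrib_left mult.left_commute)
  also have "\<dots> \<le> (\<Sum>s=0..x. fps_nth r s * (fps_nth g x * fps_nth g (y - s)))"
  proof (intro sum_mono mult_left_mono r)
    fix s assume "s \<in> {0..x}"
    then show "fps_nth g y * fps_nth g (x - s) \<le> fps_nth g x * fps_nth g (y - s)"
      using PF2_minor[OF g, of 0 s x y] xy by (simp add: toeplitz_def)
  qed
  also have "\<dots> \<le> (\<Sum>s=0..y. fps_nth r s * (fps_nth g x * fps_nth g (y - s)))"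
    by (rule sum_mono2) (use xy r g0 in auto)
  also have "\<dots> = fps_nth g x * fps_nth (r * g) y"
    by (simp add: fps_mult_nth sum_distrib_left mult.left_commute)
  finally show "fps_nth g y * fps_nth (r * g) x \<le> fps_nth g x * fps_nth (r * g) y" .
qed

text \<open>
  The two sums count \<open>P + U \<le> t, V \<le> t\<close> and \<open>U \<le> t, P + V \<le> t\<close> for fixed \<open>P = x\<close>; the reflection
  \<open>u \<mapsto> m - u\<close> exchanges the two constraints.
\<close>

lemma lr_truncation:
  fixes U V :: "nat \<Rightarrow> real"
  assumes lr: "lr_le V U"
  shows "(\<Sum>u\<le>m. of_bool (u + x \<le> t \<and> m - u \<le> t) * (U u * V (m - u)))
       \<le> (\<Sum>u\<le>m. of_bool (u \<le> t \<and> m - u + x \<le> t) * (U u * V (m - u)))"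
proof -
  define w where "w u = (of_bool (u + x \<le> t \<and> m - u \<le> t) :: real)" for u
  define d where "d u = U (m - u) * V u - U u * V (m - u)" for u
  have "(\<Sum>u\<le>m. of_bool (u \<le> t \<and> m - u + x \<le> t) * (U u * V (m - u)))
      = (\<Sum>u\<le>m. w u * (U (m - u) * V u))"
    by (rule sum.reindex_bij_witness[of _ "\<lambda>u. m - u" "\<lambda>u. m - u"]) (auto simp: w_def)
  moreover have "0 \<le> (\<Sum>u\<le>m. w u * d u)"
  proof (rule sum_nonneg_involution[where \<sigma> = "\<lambda>u. m - u"])
    fix u assume u: "u \<in> {..m}"
    show "0 \<le> (w u - w (m - u)) * d u"
    proof (cases "u \<le> m - u")
      case True
      then have "V (m - u) * U u \<le> V u * U (m - u)"
        using lr by (simp add: lr_le_def)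
      then have "0 \<le> d u"
        by (simp add: d_def mult.commute)
      \<comment> \<open>Adding \<open>x\<close> to the smaller of \<open>u\<close> and
        \<open>m - u\<close> is the weaker constraint.\<close>
      moreover have "0 \<le> w u - w (m - u)"
        using True u by (auto simp: w_def)
      ultimately show ?thesis by simp
    next
      case False
      then have "V u * U (m - u) \<le> V (m - u) * U u"
        using lr by (simp add: lr_le_def)
      then have "d u \<le> 0"
        by (simp add: d_def mult.commute)
      moreover have "w u - w (m - u) \<le> 0"
        using False u by (auto simp: w_def)
      ultimately show ?thesis by (simp add: mult_nonpos_nonpos)
    qed
  qed (auto simp: d_def)
  ultimately show ?thesis
    by (simp add: w_def d_def algebra_simps sum_subtractf)
qed

text \<open>Both coefficients sum over degrees taken from \<open>u\<close>, \<open>p\<close> and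
  \<open>v\<close> with total \<open>j\<close>. They differ only in whether the degree
  \<open>x\<close> from \<open>p\<close> is truncated together with that from \<open>u\<close> or
  with that from \<open>v\<close>. For fixed \<open>x\<close>, \<open>lr_truncation\<close> with
  \<open>m = j - x\<close> compares the inner sums.\<close>

lemma cutoff_mult_le:
  fixes p u v :: "real fps"
  assumes p: "\<And>n. 0 \<le> fps_nth p n" and lr: "lr_le (fps_nth v) (fps_nth u)"
  shows "fps_nth (fps_cutoff (Suc t) (u * p) * fps_cutoff (Suc t) v) j
       \<le> fps_nth (fps_cutoff (Suc t) u * fps_cutoff (Suc t) (v * p)) j"
proof -
  let ?P = "fps_nth p" and ?U = "fps_nth u" and ?V = "fps_nth v"
  have "fps_nth (fps_cutoff (Suc t) (u * p) * fps_cutoff (Suc t) v) j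
      = (\<Sum>k\<le>j. \<Sum>a\<le>k. of_bool (k \<le> t \<and> j - k \<le> t) * (?U a * ?P (k - a) * ?V (j - k)))"
    by (auto simp: fps_mult_nth atLeast0AtMost sum_distrib_right intro!: sum.cong)
  also have "\<dots> = (\<Sum>x\<le>j. \<Sum>a\<le>j - x. of_bool (a + x \<le> t \<and> j - x - a \<le> t) * (?P x * (?U a * ?V (j - x - a))))"
    unfolding sum.Sigma[OF finite_atMost ballI[OF finite_atMost]]
    by (rule sum.reindex_bij_witness[of _ "\<lambda>(x, a). (x + a, a)" "\<lambda>(k, a). (k - a, a)"])
       (auto simp: mult_ac)
  also have "\<dots> = (\<Sum>x\<le>j. ?P x * (\<Sum>a\<le>j - x. of_bool (a + x \<le> t \<and> j - x - a \<le> t) * (?U a * ?V (j - x - a))))"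
    by (simp add: sum_distrib_left mult_ac)
  also have "\<dots> \<le> (\<Sum>x\<le>j. ?P x * (\<Sum>a\<le>j - x. of_bool (a \<le> t \<and> j - x - a + x \<le> t) * (?U a * ?V (j - x - a))))"
    by (intro sum_mono mult_left_mono p lr_truncation lr)
  also have "\<dots> = (\<Sum>x\<le>j. \<Sum>a\<le>j - x. of_bool (a \<le> t \<and> j - x - a + x \<le> t) * (?P x * (?U a * ?V (j - x - a))))"
    by (simp add: sum_distrib_left mult_ac)
  \<comment> \<open>Now \<open>k\<close> is the degree taken from \<open>v * p\<close> and
    \<open>b\<close> the one from \<open>v\<close>, so \<open>x = k - b\<close> and
    \<open>a = j - k\<close>.\<close>
  also have "\<dots> = (\<Sum>k\<le>j. \<Sum>b\<le>k. of_bool (k \<le> t \<and> j - k \<le> t) * (?V b * ?P (k - b) * ?U (j - k)))"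
    unfolding sum.Sigma[OF finite_atMost ballI[OF finite_atMost]]
    by (rule sum.reindex_bij_witness[of _ "\<lambda>(k, b). (k - b, j - k)" "\<lambda>(x, a). (j - a, j - x - a)"])
       (auto simp: mult_ac)
  also have "\<dots> = fps_nth (fps_cutoff (Suc t) (v * p) * fps_cutoff (Suc t) u) j"
    by (auto simp: fps_mult_nth atLeast0AtMost sum_distrib_right intro!: sum.cong)
  finally show ?thesis by (simp add: mult.commute)
qed

text \<open>\<open>cutoff_mult_le\<close> moves one factor \<open>p\<close> from
  \<open>u = p ^ (a - 1)\<close> to \<open>v = p ^ b\<close>. Since \<open>b \<le> a - 1\<close>,
  \<open>u\<close> is a power of \<open>p\<close> times \<open>v\<close>, and
  \<open>lr_le_mult\<close> supplies the order.\<close>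

lemma cutoff_power_transfer_le:
  fixes p :: "real fps"
  assumes p: "PF2 (fps_nth p)" and ab: "b + 2 \<le> a"
  shows "fps_nth (fps_cutoff (Suc t) (p ^ a) * fps_cutoff (Suc t) (p ^ b)) j
       \<le> fps_nth (fps_cutoff (Suc t) (p ^ (a - 1)) * fps_cutoff (Suc t) (p ^ (b + 1))) j"
proof -
  have p0: "0 \<le> fps_nth p n" for n using p by (simp add: PF2_def)
  have r0: "0 \<le> fps_nth (p ^ m) n" for m n using PF2_power[OF p] by (simp add: PF2_def)
  have "lr_le (fps_nth (p ^ b)) (fps_nth (p ^ (a - 1 - b) * p ^ b))"
    by (rule lr_le_mult[OF PF2_power[OF p] r0])
  then have "lr_le (fps_nth (p ^ b)) (fps_nth (p ^ (a - 1)))"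
    using ab by (simp add: power_add[symmetric])
  from cutoff_mult_le[of p, OF p0 this, of t j]
  have "fps_nth (fps_cutoff (Suc t) (p ^ (a - 1) * p) * fps_cutoff (Suc t) (p ^ b)) j
       \<le> fps_nth (fps_cutoff (Suc t) (p ^ (a - 1)) * fps_cutoff (Suc t) (p ^ b * p)) j" .
  moreover have "p ^ (a - 1) * p = p ^ a"
    using ab by (metis One_nat_def add_is_0 le_zero_eq numeral_2_eq_2 nat.simps(3) neq0_conv power_minus_mult)
  ultimately show ?thesis by (simp add: mult.commute)
qed

lemma fps_mult_left_mono:
  fixes f g h :: "real fps"
  assumes "\<And>n. 0 \<le> fps_nth h n" and "\<And>n. fps_nth f n \<le> fps_nth g n"
  shows "fps_nth (h * f) n \<le> fps_nth (h * g) n"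
  unfolding fps_mult_nth by (intro sum_mono mult_left_mono assms)

lemma fps_prod_nonneg:
  fixes f :: "'a \<Rightarrow> real fps"
  assumes "\<And>i n. i \<in> A \<Longrightarrow> 0 \<le> fps_nth (f i) n"
  shows "0 \<le> fps_nth (\<Prod>i\<in>A. f i) n"
  using assms
proof (induction A arbitrary: n rule: infinite_finite_induct)
  case (insert x F)
  then show ?case by (auto simp: fps_mult_nth intro!: sum_nonneg)
qed auto

section \<open>Event probabilities as power series coefficients\<close>

text \<open>Intersecting with the supports makes both factors countable, as
  \<open>measure_pmf_prob_product\<close> requires; in the application \<open>B\<close> is a set of
  functions.\<close>

lemma measure_pair_pmf_Times:
  "measure_pmf.prob (pair_pmf p q) (A \<times> B) = measure_pmf.prob p A * measure_pmf.prob q B"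
proof -
  have "measure_pmf.prob (pair_pmf p q) (A \<times> B)
      = measure_pmf.prob (pair_pmf p q) (A \<times> B \<inter> set_pmf (pair_pmf p q))"
    by (rule measure_Int_set_pmf[symmetric])
  also have "A \<times> B \<inter> set_pmf (pair_pmf p q) = (A \<inter> set_pmf p) \<times> (B \<inter> set_pmf q)"
    by auto
  also have "measure_pmf.prob (pair_pmf p q) \<dots>
      = measure_pmf.prob p (A \<inter> set_pmf p) * measure_pmf.prob q (B \<inter> set_pmf q)"
    by (rule measure_pmf_prob_product) auto
  finally show ?thesis by (simp add: measure_Int_set_pmf)
qed

text \<open>Splitting off one coordinate cuts the event into disjoint rectangles indexed by its
  value \<open>k\<close>; adding their probabilities is convolution. The case
  \<open>B = UNIV\<close> gives the law of a sum of copies, and \<open>B = {..t}\<close> the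
  truncated event.\<close>

lemma measure_Pi_pmf_sum:
  fixes D :: "'a \<Rightarrow> nat pmf"
  assumes "finite A"
  shows "measure_pmf.prob (Pi_pmf A 0 D) {Y. (\<forall>i\<in>A. Y i \<in> B) \<and> (\<Sum>i\<in>A. Y i) = j}
       = fps_nth (\<Prod>i\<in>A. Abs_fps (\<lambda>k. if k \<in> B then pmf (D i) k else 0)) j"
  using assms
proof (induction A arbitrary: j rule: finite_induct)
  case empty
  show ?case by (simp add: indicator_def)
next
  case (insert x A)
  let ?f = "\<lambda>i. Abs_fps (\<lambda>k. if k \<in> B then pmf (D i) k else 0)"
  define E where "E j = {Y. (\<forall>i\<in>A. Y i \<in> B) \<and> (\<Sum>i\<in>A. Y i) = j}" for j
  have "measure_pmf.prob (Pi_pmf (insert x A) 0 D)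
          {Y. (\<forall>i\<in>insert x A. Y i \<in> B) \<and> (\<Sum>i\<in>insert x A. Y i) = j}
      = measure_pmf.prob (pair_pmf (D x) (Pi_pmf A 0 D))
          ((\<lambda>(y, f). f(x := y)) -` {Y. (\<forall>i\<in>insert x A. Y i \<in> B) \<and> (\<Sum>i\<in>insert x A. Y i) = j})"
    using insert by (simp add: Pi_pmf_insert)
  also have "(\<lambda>(y, f). f(x := y)) -` {Y. (\<forall>i\<in>insert x A. Y i \<in> B) \<and> (\<Sum>i\<in>insert x A. Y i) = j}
      = (\<Union>k\<in>{0..j}. ({k} \<inter> B) \<times> E (j - k))"
  proof -
    have [simp]: "(\<Sum>i\<in>A. (f(x := y)) i) = (\<Sum>i\<in>A. f i)" for f and y :: nat
      using insert by (intro sum.cong) auto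
    have [simp]: "(\<forall>i\<in>A. (f(x := y)) i \<in> B) = (\<forall>i\<in>A. f i \<in> B)" for f and y :: nat
      using insert by auto
    show ?thesis
      using insert by (auto simp: E_def simp del: fun_upd_apply) (auto simp: fun_upd_apply)
  qed
  also have "measure_pmf.prob (pair_pmf (D x) (Pi_pmf A 0 D)) \<dots>
      = (\<Sum>k=0..j. measure_pmf.prob (pair_pmf (D x) (Pi_pmf A 0 D)) (({k} \<inter> B) \<times> E (j - k)))"
    by (rule measure_pmf.finite_measure_finite_Union) (auto simp: disjoint_family_on_def)
  also have "\<dots> = (\<Sum>k=0..j. fps_nth (?f x) k * fps_nth (\<Prod>i\<in>A. ?f i) (j - k))"
  proof (rule sum.cong[OF refl])
    fix k
    have "measure_pmf.prob (pair_pmf (D x) (Pi_pmf A 0 D)) (({k} \<inter> B) \<times> E (j - k))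
        = measure_pmf.prob (D x) ({k} \<inter> B) * measure_pmf.prob (Pi_pmf A 0 D) (E (j - k))"
      by (rule measure_pair_pmf_Times)
    also have "measure_pmf.prob (D x) ({k} \<inter> B) = fps_nth (?f x) k"
      by (simp add: measure_pmf_single)
    also have "measure_pmf.prob (Pi_pmf A 0 D) (E (j - k)) = fps_nth (\<Prod>i\<in>A. ?f i) (j - k)"
      unfolding E_def by (rule insert.IH)
    finally show "measure_pmf.prob (pair_pmf (D x) (Pi_pmf A 0 D)) (({k} \<inter> B) \<times> E (j - k))
        = fps_nth (?f x) k * fps_nth (\<Prod>i\<in>A. ?f i) (j - k)" .
  qed
  also have "\<dots> = fps_nth (\<Prod>i\<in>insert x A. ?f i) j"
    using insert by (simp add: fps_mult_nth)
  finally show ?case .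
qed

lemma pmf_sum_of_copies: "pmf (sum_of_copies m X) k = fps_nth (Abs_fps (pmf X) ^ m) k"
proof -
  have "pmf (sum_of_copies m X) k
      = measure_pmf.prob (Pi_pmf {..<m} 0 (\<lambda>_. X)) {Y. (\<forall>i\<in>{..<m}. Y i \<in> UNIV) \<and> (\<Sum>i\<in>{..<m}. Y i) = k}"
    by (simp add: sum_of_copies_def pmf_map vimage_def)
  then show ?thesis
    unfolding measure_Pi_pmf_sum[OF finite_lessThan] by simp
qed

lemma partition_bounded:
  assumes "is_partition \<nu>"
  shows "\<exists>N. \<forall>i>N. \<nu> i = 0"
proof -
  have "finite {i. i \<ge> 1 \<and> \<nu> i \<noteq> 0}" using assms by (simp add: is_partition_def)
  then obtain N where "\<forall>i\<in>{i. i \<ge> 1 \<and> \<nu> i \<noteq> 0}. i \<le> N"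
    using finite_nat_set_iff_bounded_le by blast
  then have N: "i \<le> N" if "i \<ge> 1" "\<nu> i \<noteq> 0" for i
    using that by simp
  have "\<nu> i = 0" if "N < i" for i
    using N[of i] \<open>N < i\<close> by (cases "\<nu> i = 0") simp_all
  then show ?thesis by auto
qed

lemma total_sum_eq_sum:
  assumes "\<And>i. N < i \<Longrightarrow> f i = 0"
  shows "total_sum f = (\<Sum>i=1..N. f i)"
  unfolding total_sum_def
  by (rule sum.mono_neutral_left) (use assms in \<open>auto simp: not_less[symmetric]\<close>)

lemma set_law_Y_zero:
  assumes "\<And>i. N < i \<Longrightarrow> \<nu> i = 0" "Y \<in> set_pmf (law_Y \<nu> X)" "\<nu> i = 0 \<or> i = 0"
  shows "Y i = 0"
proof -
  have fin: "finite {i. i \<ge> 1 \<and> \<nu> i \<noteq> 0}"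
    by (rule finite_subset[of _ "{..N}"]) (use assms(1) in \<open>auto simp: not_less[symmetric]\<close>)
  show ?thesis
    using set_Pi_pmf_subset[OF fin, of 0 "\<lambda>i. sum_of_copies (\<nu> i) X"] assms(2,3)
    unfolding law_Y_def by auto
qed

text \<open>Almost surely only coordinates with a non-zero part contribute, so
  \<open>measure_Pi_pmf_sum\<close> applies. Any bound \<open>N\<close> on their indices is allowed,
  which lets two partitions share one product range. \<open>fps_cutoff\<close> keeps indices
  strictly below its argument, hence \<open>Suc t\<close>.\<close>

lemma prob_E_eq_coeff:
  assumes N: "\<And>i. N < i \<Longrightarrow> \<nu> i = 0"
  shows "prob_E \<nu> X j t = fps_nth (\<Prod>i=1..N. fps_cutoff (Suc t) (Abs_fps (pmf X) ^ \<nu> i)) j"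
proof -
  define A where "A = {i. i \<ge> 1 \<and> \<nu> i \<noteq> 0}"
  have A: "A \<subseteq> {1..N}" using N by (auto simp: A_def not_less[symmetric])
  then have fin: "finite A" by (rule finite_subset) simp
  have law: "Pi_pmf A 0 (\<lambda>i. sum_of_copies (\<nu> i) X) = law_Y \<nu> X"
    by (simp add: law_Y_def A_def)
  have "prob_E \<nu> X j t = measure_pmf.prob (Pi_pmf A 0 (\<lambda>i. sum_of_copies (\<nu> i) X))
          {Y. (\<forall>i\<in>A. Y i \<in> {..t}) \<and> (\<Sum>i\<in>A. Y i) = j}"
    unfolding prob_E_def law
  proof (rule measure_eq_AE)
    show "AE Y in law_Y \<nu> X. (Y \<in> {Y. (\<forall>i\<ge>1. Y i \<le> t) \<and> total_sum Y = j}) =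
        (Y \<in> {Y. (\<forall>i\<in>A. Y i \<in> {..t}) \<and> (\<Sum>i\<in>A. Y i) = j})"
    proof (unfold AE_measure_pmf_iff, rule ballI)
      fix Y assume Y: "Y \<in> set_pmf (law_Y \<nu> X)"
      have Y0: "Y i = 0" if "i \<notin> A" for i
        by (rule set_law_Y_zero[OF N Y]) (use that in \<open>auto simp: A_def\<close>)
      have "i \<in> A" if "Y i \<noteq> 0" for i using Y0[of i] that by metis
      then have "{i. i \<ge> 1 \<and> Y i \<noteq> 0} \<subseteq> A" by auto
      then have "total_sum Y = (\<Sum>i\<in>A. Y i)"
        unfolding total_sum_def
        by (rule sum.mono_neutral_left[OF fin]) (auto simp: A_def)
      moreover have "(\<forall>i\<ge>1. Y i \<le> t) = (\<forall>i\<in>A. Y i \<in> {..t})"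
      proof
        assume *: "\<forall>i\<in>A. Y i \<in> {..t}"
        show "\<forall>i\<ge>1. Y i \<le> t"
        proof (intro allI impI)
          fix i show "Y i \<le> t" using * Y0[of i] by (cases "i \<in> A") auto
        qed
      qed (auto simp: A_def)
      ultimately show "(Y \<in> {Y. (\<forall>i\<ge>1. Y i \<le> t) \<and> total_sum Y = j}) =
        (Y \<in> {Y. (\<forall>i\<in>A. Y i \<in> {..t}) \<and> (\<Sum>i\<in>A. Y i) = j})" by simp
    qed
  qed auto
  also have "\<dots> = fps_nth (\<Prod>i\<in>A. Abs_fps (\<lambda>k. if k \<in> {..t} then pmf (sum_of_copies (\<nu> i) X) k else 0)) j"
    by (rule measure_Pi_pmf_sum[OF fin])
  also have "(\<Prod>i\<in>A. Abs_fps (\<lambda>k. if k \<in> {..t} then pmf (sum_of_copies (\<nu> i) X) k else 0))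
      = (\<Prod>i\<in>A. fps_cutoff (Suc t) (Abs_fps (pmf X) ^ \<nu> i))"
    by (intro prod.cong refl) (auto simp: fps_eq_iff pmf_sum_of_copies)
  also have "\<dots> = (\<Prod>i=1..N. fps_cutoff (Suc t) (Abs_fps (pmf X) ^ \<nu> i))"
  proof (rule prod.mono_neutral_left)
    \<comment> \<open>A zero part contributes the series 1, which the cutoff leaves unchanged since
      \<open>Suc t > 0\<close>.\<close>
    have "fps_cutoff (Suc t) (1 :: real fps) = 1" by (auto simp: fps_eq_iff)
    then show "\<forall>i\<in>{1..N} - A. fps_cutoff (Suc t) (Abs_fps (pmf X) ^ \<nu> i) = 1"
      by (auto simp: A_def)
  qed (use A in auto)
  finally show ?thesis .
qed

section \<open>Unit transfers and dominance\<close>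

text \<open>Only the factors at \<open>i\<close> and \<open>k\<close> change; the product of the
  others has non-negative coefficients, so multiplying by it preserves the two-factor
  inequality.\<close>

lemma prod_cutoff_transfer_le:
  fixes p :: "real fps"
  assumes p: "PF2 (fps_nth p)" and ik: "i \<in> A" "k \<in> A" "i \<noteq> k" and fin: "finite A"
    and ge: "\<nu> k + 2 \<le> \<nu> i"
  shows "fps_nth (\<Prod>l\<in>A. fps_cutoff (Suc t) (p ^ \<nu> l)) j
       \<le> fps_nth (\<Prod>l\<in>A. fps_cutoff (Suc t) (p ^ (\<nu>(i := \<nu> i - 1, k := \<nu> k + 1)) l)) j"
proof -
  define c where "c m = fps_cutoff (Suc t) (p ^ m)" for m
  let ?\<nu> = "\<nu>(i := \<nu> i - 1, k := \<nu> k + 1)"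
  have split: "(\<Prod>l\<in>A. c (\<kappa> l)) = (\<Prod>l\<in>A - {i} - {k}. c (\<kappa> l)) * (c (\<kappa> i) * c (\<kappa> k))" for \<kappa>
    using ik fin by (simp add: prod.remove[of A i] prod.remove[of "A - {i}" k] mult_ac)
  have c0: "0 \<le> fps_nth (c m) n" for m n
    using PF2_power[OF p] by (simp add: c_def PF2_def)
  have "(\<Prod>l\<in>A - {i} - {k}. c (?\<nu> l)) = (\<Prod>l\<in>A - {i} - {k}. c (\<nu> l))"
    by (rule prod.cong) auto
  moreover have "fps_nth ((\<Prod>l\<in>A - {i} - {k}. c (\<nu> l)) * (c (\<nu> i) * c (\<nu> k))) j
      \<le> fps_nth ((\<Prod>l\<in>A - {i} - {k}. c (\<nu> l)) * (c (\<nu> i - 1) * c (\<nu> k + 1))) j"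
    by (intro fps_mult_left_mono fps_prod_nonneg c0)
       (unfold c_def, rule cutoff_power_transfer_le[OF p ge])
  ultimately show ?thesis
    unfolding c_def[symmetric] split using ik by simp
qed

text \<open>
  Muirhead's reduction: if \<open>k\<close> is the first index with \<open>\<nu> k < \<mu> k\<close>, then some \<open>i < k\<close> has \<open>\<nu> i > \<mu> i\<close>, and
  moving a unit from \<open>i\<close> to \<open>k\<close> preserves domination of \<open>\<mu>\<close>, although it may leave the class of
  partitions.
\<close>

lemma majorization_transfer_induct:
  fixes \<nu> \<mu> :: "nat \<Rightarrow> nat" and F :: "(nat \<Rightarrow> nat) \<Rightarrow> real"
  assumes anti: "antimono_on {1..N} \<mu>"
    and dom: "\<And>j. j \<le> N \<Longrightarrow> (\<Sum>i=1..j. \<mu> i) \<le> (\<Sum>i=1..j. \<nu> i)"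
    and total: "(\<Sum>i=1..N. \<nu> i) = (\<Sum>i=1..N. \<mu> i)"
    and cong: "\<And>\<kappa> \<kappa>'. (\<And>i. i \<in> {1..N} \<Longrightarrow> \<kappa> i = \<kappa>' i) \<Longrightarrow> F \<kappa> = F \<kappa>'"
    and step: "\<And>\<kappa> i k. i \<in> {1..N} \<Longrightarrow> k \<in> {1..N} \<Longrightarrow> i \<noteq> k \<Longrightarrow> \<kappa> k + 2 \<le> \<kappa> i \<Longrightarrow>
      F \<kappa> \<le> F (\<kappa>(i := \<kappa> i - 1, k := \<kappa> k + 1))"
  shows "F \<nu> \<le> F \<mu>"
  using dom total
\<comment> \<open>The measure is the total excess of \<open>\<nu>\<close> over \<open>\<mu>\<close>:
  natural subtraction discards the indices where \<open>\<nu>\<close> is smaller.\<close>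
proof (induction "\<Sum>i=1..N. \<nu> i - \<mu> i" arbitrary: \<nu> rule: less_induct)
  case (less \<nu>)
  show ?case
  proof (cases "\<exists>k. k \<in> {1..N} \<and> \<nu> k < \<mu> k")
    case False
    then have ge: "\<mu> i \<le> \<nu> i" if "i \<in> {1..N}" for i
      using that by (meson not_less)
    have "\<nu> i = \<mu> i" if i: "i \<in> {1..N}" for i
    proof (rule ccontr)
      assume "\<nu> i \<noteq> \<mu> i"
      then have "(\<Sum>i=1..N. \<mu> i) < (\<Sum>i=1..N. \<nu> i)"
        using ge i by (intro sum_strict_mono_ex1 bexI[of _ i]) (auto simp: less_le)
      then show False using less.prems by simp
    qed
    then have "F \<nu> = F \<mu>" by (rule cong)
    then show ?thesis by simp
  next
    case True
    define k where "k = (LEAST k. k \<in> {1..N} \<and> \<nu> k < \<mu> k)"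
    have k: "k \<in> {1..N}" "\<nu> k < \<mu> k"
      using LeastI_ex[OF True] unfolding k_def by auto
    have before: "\<mu> l \<le> \<nu> l" if "1 \<le> l" "l < k" for l
      using not_less_Least[OF that(2)[unfolded k_def]] that k by auto
    have "\<exists>i\<in>{1..<k}. \<mu> i < \<nu> i"
    proof (rule ccontr)
      assume "\<not> ?thesis"
      then have "(\<Sum>i=1..<k. \<nu> i) \<le> (\<Sum>i=1..<k. \<mu> i)"
        by (intro sum_mono) (auto simp: not_less)
      moreover have "(\<Sum>i=1..k. \<kappa> i) = (\<Sum>i=1..<k. \<kappa> i) + \<kappa> k" for \<kappa> :: "nat \<Rightarrow> nat"
        using k by (simp add: sum.last_plus)
      ultimately show False using less.prems(1)[of k] k by simp
    qed
    then obtain i where i: "1 \<le> i" "i < k" "\<mu> i < \<nu> i" by auto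
    have "\<mu> k \<le> \<mu> i" using anti i k by (auto simp: monotone_on_def)
    then have gap: "\<nu> k + 2 \<le> \<nu> i" using i k by simp
    define \<nu>' where "\<nu>' = \<nu>(i := \<nu> i - 1, k := \<nu> k + 1)"
    have sums: "(\<Sum>l=1..j. \<nu>' l) + of_bool (i \<le> j) = (\<Sum>l=1..j. \<nu> l) + of_bool (k \<le> j)" for j
    proof -
      have "(\<Sum>l=1..j. \<nu>' l + of_bool (l = i)) = (\<Sum>l=1..j. \<nu> l + of_bool (l = k))"
        using i gap by (intro sum.cong) (auto simp: \<nu>'_def)
      then show ?thesis
        using i k by (simp add: sum.distrib of_bool_def)
    qed
    have "F \<nu> \<le> F \<nu>'"
      unfolding \<nu>'_def by (rule step) (use i k gap in auto)
    also have "F \<nu>' \<le> F \<mu>"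
    proof (rule less.hyps)
      \<comment> \<open>The excess drops by one at \<open>i\<close> and stays 0 at \<open>k\<close>,
        because \<open>\<nu> k + 1 \<le> \<mu> k\<close>.\<close>
      show "(\<Sum>i=1..N. \<nu>' i - \<mu> i) < (\<Sum>i=1..N. \<nu> i - \<mu> i)"
        using i k by (intro sum_strict_mono_ex1 bexI[of _ i]) (auto simp: \<nu>'_def)
      show "(\<Sum>i=1..N. \<nu>' i) = (\<Sum>i=1..N. \<mu> i)"
        using sums[of N] less.prems(2) i k by simp
      fix j assume j: "j \<le> N"
      show "(\<Sum>i=1..j. \<mu> i) \<le> (\<Sum>i=1..j. \<nu>' i)"
      \<comment> \<open>Only for \<open>i \<le> j < k\<close> does the transfer lower the partial
        sum, by one. There domination was strict: \<open>\<nu>\<close> is at least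
        \<open>\<mu>\<close> before \<open>k\<close> and larger at \<open>i\<close>.\<close>
      proof (cases "i \<le> j \<and> j < k")
        case True
        then have "(\<Sum>i=1..j. \<mu> i) < (\<Sum>i=1..j. \<nu> i)"
          using i before by (intro sum_strict_mono_ex1 bexI[of _ i]) auto
        then show ?thesis using sums[of j] True by simp
      next
        case False
        then show ?thesis using sums[of j] less.prems(1)[OF j] i
          by (cases "i \<le> j"; cases "k \<le> j") auto
      qed
    qed
    finally show ?thesis .
  qed
qed

text \<open>For fixed \<open>j\<close> and \<open>t\<close>, the coefficient of the truncated
  product serves as the functional \<open>F\<close> of the exponents. It makes sense for every
  exponent function on \<open>{1..N}\<close>, so the intermediate functions may fail to be
  partitions.\<close>

lemma dominates_imp_cond_C:
  assumes lam: "is_partition lam" and mu: "is_partition \<mu>" and dom: "dominates lam \<mu>"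
    and X: "rv_TN2 X"
  shows "cond_C lam \<mu> X"
  unfolding cond_C_def
proof (intro allI)
  fix j t
  obtain N1 where N1: "\<forall>i>N1. lam i = 0" using partition_bounded[OF lam] by blast
  obtain N2 where N2: "\<forall>i>N2. \<mu> i = 0" using partition_bounded[OF mu] by blast
  define N where "N = max N1 N2"
  have Nl: "N < i \<Longrightarrow> lam i = 0" and Nm: "N < i \<Longrightarrow> \<mu> i = 0" for i
    using N1 N2 by (auto simp: N_def)
  have p: "PF2 (fps_nth (Abs_fps (pmf X)))"
    using TN2_imp_PF2[OF X[unfolded rv_TN2_def]] by (simp add: Abs_fps_inverse)
  show "prob_E lam X j t \<le> prob_E \<mu> X j t"
  proof (simp only: prob_E_eq_coeff[of N lam, OF Nl] prob_E_eq_coeff[of N \<mu>, OF Nm], rule majorization_transfer_induct[where N = N and \<nu> = lam and \<mu> = \<mu> and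
        F = "\<lambda>\<kappa>. fps_nth (\<Prod>i=1..N. fps_cutoff (Suc t) (Abs_fps (pmf X) ^ \<kappa> i)) j"])
    show "antimono_on {1..N} \<mu>"
      using mu unfolding is_partition_def by (auto simp: monotone_on_def)
    show "(\<Sum>i=1..N. lam i) = (\<Sum>i=1..N. \<mu> i)"
      using dom total_sum_eq_sum[of N lam, OF Nl] total_sum_eq_sum[of N \<mu>, OF Nm]
      by (simp add: dominates_def)
    show "(\<Sum>i=1..j. \<mu> i) \<le> (\<Sum>i=1..j. lam i)" for j
      using dom by (cases "j = 0") (auto simp: dominates_def)
  next
    fix \<kappa> \<kappa>' :: "nat \<Rightarrow> nat" assume eq: "\<And>i. i \<in> {1..N} \<Longrightarrow> \<kappa> i = \<kappa>' i"
    have "(\<Prod>i=1..N. fps_cutoff (Suc t) (Abs_fps (pmf X) ^ \<kappa> i))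
        = (\<Prod>i=1..N. fps_cutoff (Suc t) (Abs_fps (pmf X) ^ \<kappa>' i))"
      by (rule prod.cong) (simp_all only: eq)
    then show "fps_nth (\<Prod>i=1..N. fps_cutoff (Suc t) (Abs_fps (pmf X) ^ \<kappa> i)) j
        = fps_nth (\<Prod>i=1..N. fps_cutoff (Suc t) (Abs_fps (pmf X) ^ \<kappa>' i)) j"
      by (rule arg_cong)
  next
    fix \<kappa> :: "nat \<Rightarrow> nat" and i k
    assume "i \<in> {1..N}" "k \<in> {1..N}" "i \<noteq> k" "\<kappa> k + 2 \<le> \<kappa> i"
    then show "fps_nth (\<Prod>l=1..N. fps_cutoff (Suc t) (Abs_fps (pmf X) ^ \<kappa> l)) j
        \<le> fps_nth (\<Prod>l=1..N. fps_cutoff (Suc t)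
            (Abs_fps (pmf X) ^ (\<kappa>(i := \<kappa> i - 1, k := \<kappa> k + 1)) l)) j"
      by (intro prod_cutoff_transfer_le p finite_atLeastAtMost)
  qed
qed

section \<open>Fair coin flips and the converse direction\<close>

definition coin :: "nat pmf" where
  "coin = pmf_of_set {0, 1}"

lemma set_coin: "set_pmf coin = {0, 1}"
  by (simp add: coin_def)

text \<open>The Toeplitz matrix is bidiagonal. A non-zero antidiagonal product in rows
  \<open>i < i'\<close> and columns \<open>j < j'\<close> would force
  \<open>i' \<le> j < j' \<le> i + 1\<close>, which is impossible.\<close>

lemma rv_TN2_coin: "rv_TN2 coin"
proof -
  have "pmf coin = (\<lambda>n. if n \<le> 1 then 1 / 2 else 0)"
    by (auto simp: coin_def fun_eq_iff indicator_def)
  then show ?thesis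
    unfolding rv_TN2_def by (intro TN2_toeplitzI) (auto simp: toeplitz_def)
qed

lemma set_sum_of_copies_coin: "set_pmf (sum_of_copies m coin) = {..m}"
proof -
  have S: "set_pmf (sum_of_copies m coin) = (\<lambda>x. \<Sum>k<m. x k) ` PiE_dflt {..<m} 0 (\<lambda>_. {0, 1})"
    by (simp add: sum_of_copies_def set_Pi_pmf set_coin comp_def)
  show ?thesis
  proof (intro equalityI subsetI)
    fix s assume "s \<in> set_pmf (sum_of_copies m coin)"
    then obtain x where x: "s = (\<Sum>k<m. x k)" "x \<in> PiE_dflt {..<m} 0 (\<lambda>_. {0, 1})"
      unfolding S by auto
    have "(\<Sum>k<m. x k) \<le> (\<Sum>k<m. 1)"
      by (rule sum_mono) (use x(2) in \<open>force simp: PiE_dflt_def\<close>)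
    then show "s \<in> {..m}" using x by simp
  next
    fix s assume "s \<in> {..m}"
    then have "s \<le> m" by simp
    \<comment> \<open>The value \<open>s\<close> is realised by ones in exactly the first
      \<open>s\<close> coordinates.\<close>
    define x where "x k = (if k < s then 1 else 0 :: nat)" for k
    have "(\<Sum>k<m. x k) = (\<Sum>k<s. 1)"
      unfolding x_def using \<open>s \<le> m\<close> by (intro sum.mono_neutral_cong_right) auto
    moreover have "x \<in> PiE_dflt {..<m} 0 (\<lambda>_. {0, 1})"
      using \<open>s \<le> m\<close> by (auto simp: x_def PiE_dflt_def)
    ultimately show "s \<in> set_pmf (sum_of_copies m coin)"
      unfolding S by (intro image_eqI[of _ _ x]) auto
  qed
qed

text \<open>Only possibility of the event is compared: the largest total attainable for
  \<open>lam\<close> has positive probability, hence is attainable for \<open>\<mu>\<close>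
  too.\<close>

lemma sum_min_le_of_cond_C:
  assumes Nl: "\<And>i. N < i \<Longrightarrow> lam i = 0" and Nm: "\<And>i. N < i \<Longrightarrow> \<mu> i = 0"
    and C: "cond_C lam \<mu> coin"
  shows "(\<Sum>i=1..N. min (lam i) t) \<le> (\<Sum>i=1..N. min (\<mu> i) t)"
proof -
  define j where "j = (\<Sum>i=1..N. min (lam i) t)"
  have supp: "set_pmf (law_Y \<nu> coin) = PiE_dflt {i. 1 \<le> i \<and> \<nu> i \<noteq> 0} 0 (\<lambda>i. {..\<nu> i})"
    if "\<And>i. N < i \<Longrightarrow> \<nu> i = 0" for \<nu>
  proof -
    have "finite {i. 1 \<le> i \<and> \<nu> i \<noteq> 0}"
      by (rule finite_subset[of _ "{..N}"]) (use that in \<open>auto simp: not_less[symmetric]\<close>)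
    then show ?thesis
      by (simp add: law_Y_def set_Pi_pmf set_sum_of_copies_coin comp_def)
  qed
  \<comment> \<open>Each coordinate takes its largest admissible value; index 0 must carry the
    default value of \<open>Pi_pmf\<close>.\<close>
  define Y where "Y i = (if i = 0 then 0 else min (lam i) t)" for i
  have "Y \<in> set_pmf (law_Y lam coin)"
    by (subst supp[of lam]) (auto simp: PiE_dflt_def Y_def Nl)
  moreover have "total_sum Y = j"
    unfolding j_def by (subst total_sum_eq_sum[of N]) (auto simp: Y_def Nl)
  ultimately have "prob_E lam coin j t \<noteq> 0"
    unfolding prob_E_def measure_pmf_zero_iff by (auto simp: Y_def)
  then have "prob_E lam coin j t > 0"
    by (simp add: prob_E_def zero_less_measure_iff)
  also have "\<dots> \<le> prob_E \<mu> coin j t" using C by (simp add: cond_C_def)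
  finally have "prob_E \<mu> coin j t \<noteq> 0" by simp
  then obtain Z where Z: "Z \<in> set_pmf (law_Y \<mu> coin)" "\<And>i. i \<ge> 1 \<Longrightarrow> Z i \<le> t" "total_sum Z = j"
    unfolding prob_E_def measure_pmf_zero_iff by auto
  have Zle: "Z i \<le> \<mu> i" if "i \<ge> 1" for i
    using Z(1) that supp[of \<mu>, OF Nm] unfolding PiE_dflt_def by fastforce
  have "Z i = 0" if "N < i" for i
    using Zle[of i] Nm[OF that] that by simp
  then have "j = (\<Sum>i=1..N. Z i)"
    using Z(3) total_sum_eq_sum[of N Z] by simp
  also have "\<dots> \<le> (\<Sum>i=1..N. min (\<mu> i) t)"
    by (rule sum_mono) (use Z(2) Zle in auto)
  finally show ?thesis unfolding j_def .
qed

text \<open>The truncation level \<open>t = lam j\<close> detects the partial sum up to \<open>j\<close>.\<close>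

lemma partial_sum_le_of_sum_min_le:
  fixes lam \<mu> :: "nat \<Rightarrow> nat"
  assumes anti: "antimono_on {1..} lam" and j: "1 \<le> j" "j \<le> N"
    and total: "(\<Sum>i=1..N. lam i) = (\<Sum>i=1..N. \<mu> i)"
    and le: "(\<Sum>i=1..N. min (lam i) (lam j)) \<le> (\<Sum>i=1..N. min (\<mu> i) (lam j))"
  shows "(\<Sum>i=1..j. \<mu> i) \<le> (\<Sum>i=1..j. lam i)"
proof -
  have anti': "lam k \<le> lam i" if "1 \<le> i" "i \<le> k" for i k
    by (rule monotone_onD[OF anti]) (use that in auto)
  \<comment> \<open>A part is its truncation at \<open>lam j\<close> plus its excess above that
    level, so with equal totals the larger truncated sum leaves the smaller excess.\<close>
  have excess: "(\<Sum>i=1..N. \<nu> i) = (\<Sum>i=1..N. min (\<nu> i) (lam j)) + (\<Sum>i=1..N. \<nu> i - lam j)"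
    for \<nu> :: "nat \<Rightarrow> nat"
    by (subst sum.distrib[symmetric]) (auto intro: sum.cong)
  have "(\<Sum>i=1..j. \<mu> i) \<le> (\<Sum>i=1..j. lam j + (\<mu> i - lam j))"
    by (rule sum_mono) auto
  also have "\<dots> = (\<Sum>i=1..j. lam j) + (\<Sum>i=1..j. \<mu> i - lam j)"
    by (rule sum.distrib)
  also have "(\<Sum>i=1..j. \<mu> i - lam j) \<le> (\<Sum>i=1..N. \<mu> i - lam j)"
    by (rule sum_mono2) (use j in auto)
  also have "\<dots> \<le> (\<Sum>i=1..N. lam i - lam j)"
    using excess[of lam] excess[of \<mu>] total le by linarith
  \<comment> \<open>After \<open>j\<close> the parts of \<open>lam\<close> have no excess; up to
    \<open>j\<close> they are at least \<open>lam j\<close>, so level and excess add up to the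
    part.\<close>
  also have "\<dots> = (\<Sum>i=1..j. lam i - lam j)"
    by (rule sum.mono_neutral_right) (use j anti'[of j] in auto)
  also have "(\<Sum>i=1..j. lam j) + (\<Sum>i=1..j. lam i - lam j) = (\<Sum>i=1..j. lam i)"
    unfolding sum.distrib[symmetric]
    by (rule sum.cong) (use anti'[of _ j] in auto)
  finally show ?thesis by simp
qed

theorem theorem2:
  fixes n :: nat and lam \<mu> :: "nat \<Rightarrow> nat"
  assumes "is_partition_of lam n" and "is_partition_of \<mu> n"
  shows "dominates lam \<mu> \<longleftrightarrow> (\<forall>X :: nat pmf. rv_TN2 X \<longrightarrow> cond_C lam \<mu> X)"
proof
  assume "dominates lam \<mu>"
  then show "\<forall>X. rv_TN2 X \<longrightarrow> cond_C lam \<mu> X"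
    using assms by (auto simp: is_partition_of_def intro: dominates_imp_cond_C)
next
  assume "\<forall>X. rv_TN2 X \<longrightarrow> cond_C lam \<mu> X"
  then have C: "cond_C lam \<mu> coin" using rv_TN2_coin by blast
  have lam: "is_partition lam" and mu: "is_partition \<mu>" and eq: "total_sum lam = total_sum \<mu>"
    using assms by (auto simp: is_partition_of_def)
  obtain N1 where N1: "\<forall>i>N1. lam i = 0" using partition_bounded[OF lam] by blast
  obtain N2 where N2: "\<forall>i>N2. \<mu> i = 0" using partition_bounded[OF mu] by blast
  show "dominates lam \<mu>"
    unfolding dominates_def
  proof (intro conjI allI impI eq)
    fix j :: nat assume j: "1 \<le> j"
    \<comment> \<open>Including \<open>j\<close> in the maximum also covers partial sums that run
      past both supports.\<close>
    define N where "N = max j (max N1 N2)"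
    have Nl: "N < i \<Longrightarrow> lam i = 0" and Nm: "N < i \<Longrightarrow> \<mu> i = 0" for i
      using N1 N2 by (auto simp: N_def)
    have "(\<Sum>i=1..N. lam i) = (\<Sum>i=1..N. \<mu> i)"
      using eq total_sum_eq_sum[of N lam, OF Nl] total_sum_eq_sum[of N \<mu>, OF Nm] by simp
    moreover have "antimono_on {1..} lam" using lam by (simp add: is_partition_def)
    moreover have "j \<le> N" by (simp add: N_def)
    ultimately show "(\<Sum>i=1..j. \<mu> i) \<le> (\<Sum>i=1..j. lam i)"
      using j sum_min_le_of_cond_C[of N lam \<mu>, OF Nl Nm C] partial_sum_le_of_sum_min_le by blast
  qed
qed

end
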